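(* For every $\varepsilon>0$ there exist a categorical random variable $Y$ (with some finite number $K$ of levels) and a random variable $X$ such that $$\max_{\ell\in\mathcal{L}_Y}\xi(X,\ell(Y))-\min_{\ell\in\mathcal{L}_Y}\xi(X,\ell(Y))>1-\varepsilon .$$
   Context: For a categorical random variable $Y$ with $K$ levels, $\mathcal{L}_Y$ denotes the class of all bijections between the $K$ levels of $Y$ and the integers $\{1,\ldots,K\}$. For a random variable $X$ and a (non-constant) real-valued random variable $T$ with distribution function $F(t)=P(T\le t)$, Chatterjee's dependence coefficient is $$\xi(X,T)=\frac{\int \mathrm{Var}\big(P(T\ge t\mid X)\big)\,dF(t)}{\int \mathrm{Var}\big(1\{T\ge t\}\big)\,dF(t)}.$$ *)

theory Defs
  imports "HOL-Probability.Probability"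
begin

text \<open>
  The conditional probability of an event given \<open>X\<close> is the conditional expectation of its
  indicator given the sigma-algebra generated by \<open>X\<close>; it is a random variable on \<open>M\<close>, determined
  up to null sets, so its variance does not depend on the version.
\<close>

definition cond_prob_given ::
  "'w measure \<Rightarrow> 'x measure \<Rightarrow> ('w \<Rightarrow> 'x) \<Rightarrow> 'w set \<Rightarrow> 'w \<Rightarrow> real"
where
  "cond_prob_given M N X A =
     real_cond_exp M (vimage_algebra (space M) X N) (indicator A)"

text \<open>
  Integration against \<open>dF\<close> is integration against the Lebesgue-Stieltjes measure of the
  distribution function \<open>F\<close> of \<open>T\<close>. The coefficient is meaningful only if \<open>T\<close> is not almost
  surely constant: otherwise the denominator vanishes and the quotient is \<open>0\<close> by convention.
\<close>

definition chatterjee_xi ::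
  "'w measure \<Rightarrow> 'x measure \<Rightarrow> ('w \<Rightarrow> 'x) \<Rightarrow> ('w \<Rightarrow> real) \<Rightarrow> real"
where
  "chatterjee_xi M N X T =
     (let F = cdf (distr M borel T) in
      (\<integral>t. prob_space.variance M (cond_prob_given M N X {\<omega> \<in> space M. T \<omega> \<ge> t})
         \<partial>interval_measure F) /
      (\<integral>t. prob_space.variance M (indicator {\<omega> \<in> space M. T \<omega> \<ge> t})
         \<partial>interval_measure F))"

text \<open>
  The levels are the values that are taken with positive probability; they carry no order or
  arithmetic structure.
\<close>

definition categorical_rv :: "'w measure \<Rightarrow> 'a set \<Rightarrow> ('w \<Rightarrow> 'a) \<Rightarrow> bool"
where
  "categorical_rv M L Y \<longleftrightarrow>
     finite L \<and> Y \<in> measurable M (count_space L) \<and>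
     (\<forall>y\<in>L. measure M {\<omega> \<in> space M. Y \<omega> = y} > 0)"

text \<open>
  Labelings are taken extensional, so that each bijection on \<open>L\<close> is represented by exactly one
  function and the set of labelings is finite.
\<close>

definition labelings :: "'a set \<Rightarrow> ('a \<Rightarrow> nat) set"
where
  "labelings L = {l \<in> extensional L. bij_betw l L {1..card L}}"

definition as_constant :: "'w measure \<Rightarrow> ('w \<Rightarrow> 'a) \<Rightarrow> bool"
where
  "as_constant M T \<longleftrightarrow> (\<exists>c. AE \<omega> in M. T \<omega> = c)"

end

theory Submission
  imports Defs
begin

text \<open>
  Let \<open>Y\<close> be uniform on \<open>n\<^sup>2\<close> levels \<open>(i, b)\<close> with \<open>i, b < n\<close>, and let \<open>X = i\<close>. For every labeling the
  label is uniform on \<open>{1..n\<^sup>2}\<close>, so the denominator of \<open>\<xi>\<close> is always \<open>(1 - 1 / n\<^sup>4) / 6 \<ge> 1 / 8\<close>. If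
  the levels are ordered by \<open>i\<close> first, then \<open>X\<close> decides each event \<open>T \<ge> t\<close> except on the single block
  that contains \<open>t\<close>, hence \<open>\<xi> \<ge> 1 - 8 / n\<close>. If they are ordered by \<open>b\<close> first, then
  \<open>P(T \<ge> t | X)\<close> varies by at most \<open>1 / n\<close>, hence \<open>\<xi> \<le> 8 / n\<^sup>2\<close>.
\<close>

section \<open>Chatterjee's coefficient over a probability mass function\<close>

text \<open>A real distribution is determined by its distribution function. This turns integration
  against \<open>dF\<close> into integration against the law of \<open>T\<close>.\<close>

lemma interval_measure_cdf:
  assumes "real_distribution \<mu>"
  shows "interval_measure (cdf \<mu>) = \<mu>"
proof -
  interpret real_distribution \<mu> by fact
  have *: "(cdf \<mu> \<longlongrightarrow> 0) at_bot" "(cdf \<mu> \<longlongrightarrow> 1) at_top"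
    by (rule cdf_lim_at_bot cdf_lim_at_top_prob)+
  have "real_distribution (interval_measure (cdf \<mu>))"
    by (intro real_distribution_interval_measure cdf_nondecreasing cdf_is_right_cont *)
  moreover have "cdf (interval_measure (cdf \<mu>)) = cdf \<mu>"
    by (intro cdf_interval_measure cdf_nondecreasing cdf_is_right_cont *)
  ultimately show ?thesis
    using assms by (intro cdf_unique)
qed

text \<open>Change of variables along \<open>T\<close>: the threshold becomes an independent copy of
  the label, so both integrals are averages over the labels that occur.\<close>

lemma chatterjee_xi_pmf:
  fixes p :: "'a pmf" and \<tau> :: "'a \<Rightarrow> nat"
  defines "V \<equiv> \<lambda>f. measure_pmf.variance p f"
  shows "chatterjee_xi p N X (\<lambda>\<omega>. real (\<tau> \<omega>)) =
    measure_pmf.expectation p (\<lambda>\<omega>. V (cond_prob_given p N X {\<omega>'. \<tau> \<omega>' \<ge> \<tau> \<omega>})) /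
    measure_pmf.expectation p (\<lambda>\<omega>. V (indicator {\<omega>'. \<tau> \<omega>' \<ge> \<tau> \<omega>}))"
proof -
  let ?T = "\<lambda>\<omega>. real (\<tau> \<omega>)"
  have distr: "interval_measure (cdf (distr p borel ?T)) = distr p borel ?T"
    by (intro interval_measure_cdf prob_space.real_distribution_distr measure_pmf.prob_space_axioms) simp
  have int: "(\<integral>t. h {\<omega>. real (\<tau> \<omega>) \<ge> t} \<partial>distr p borel ?T) =
      measure_pmf.expectation p (\<lambda>\<omega>. h {\<omega>'. \<tau> \<omega>' \<ge> \<tau> \<omega>})" for h :: "'a set \<Rightarrow> real"
  proof -
    \<comment> \<open>The functional \<open>h\<close> is arbitrary, so measurability in
      \<open>t\<close> must come from the event itself: for integer labels it depends on
      \<open>t\<close> only through the ceiling, and every function on a discrete space is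
      measurable.\<close>
    have "{\<omega>. real (\<tau> \<omega>) \<ge> t} = {\<omega>. int (\<tau> \<omega>) \<ge> \<lceil>t\<rceil>}" for t
      by (auto simp: ceiling_le_iff)
    then have eq: "(\<lambda>t. h {\<omega>. real (\<tau> \<omega>) \<ge> t}) = (\<lambda>k. h {\<omega>. int (\<tau> \<omega>) \<ge> k}) \<circ> ceiling"
      by (simp add: fun_eq_iff)
    have "(\<lambda>t. h {\<omega>. real (\<tau> \<omega>) \<ge> t}) \<in> borel_measurable borel"
      unfolding eq by (rule measurable_comp[of _ _ "count_space UNIV"]) simp_all
    then show ?thesis
      by (subst integral_distr) simp_all
  qed
  show ?thesis
    unfolding chatterjee_xi_def Let_def distr V_def
    using int[of "\<lambda>A. measure_pmf.variance p (cond_prob_given p N X A)"]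
      int[of "\<lambda>A. measure_pmf.variance p (indicator A)"] by simp
qed

section \<open>Conditional probabilities on discrete and finite uniform spaces\<close>

lemma integrable_indicator_pmf [simp]: "integrable (measure_pmf p) (indicat_real A)"
  by (rule measure_pmf.integrable_const_bound[where B = 1]) simp_all

lemma finite_measure_subalgebra_vimage_pmf:
  fixes X :: "'a \<Rightarrow> 'b"
  assumes "space N = UNIV"
  shows "finite_measure_subalgebra (measure_pmf p) (vimage_algebra UNIV X N)"
  by unfold_locales (auto simp: subalgebra_def)

lemma expectation_cond_prob_given_pmf:
  assumes "space N = UNIV"
  shows "measure_pmf.expectation p (cond_prob_given p N X A) = measure_pmf.prob p A"
proof -
  interpret finite_measure_subalgebra "measure_pmf p" "vimage_algebra UNIV X N"
    by (rule finite_measure_subalgebra_vimage_pmf) fact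
  show ?thesis
    unfolding cond_prob_given_def by (simp add: real_cond_exp_int(2))
qed

text \<open>The conditional expectation is constant on each fibre of \<open>X\<close> and has the
  same integral over the fibre as the indicator, so it is the average of the indicator there. The T1
  assumption makes singletons Borel, hence fibres measurable. The value is exact at each point of
  \<open>S\<close>, not only up to null sets.\<close>

lemma cond_prob_given_pmf_of_set:
  fixes X :: "'a \<Rightarrow> 'b::t1_space"
  assumes S: "finite S" and \<omega>: "\<omega> \<in> S"
  defines "C \<equiv> {\<omega>'\<in>S. X \<omega>' = X \<omega>}"
  shows "cond_prob_given (measure_pmf (pmf_of_set S)) borel X A \<omega> = card (C \<inter> A) / card C"
proof -
  let ?M = "measure_pmf (pmf_of_set S)" and ?F = "vimage_algebra UNIV X borel"
  interpret finite_measure_subalgebra ?M ?F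
    by (rule finite_measure_subalgebra_vimage_pmf) simp
  let ?g = "real_cond_exp ?M ?F (indicator A)"
  let ?B = "X -` {X \<omega>}"
  have S': "S \<noteq> {}" "card S > 0" using S \<omega> by (auto simp: card_gt_0_iff)
  have B: "?B \<in> sets ?F"
    using in_vimage_algebra[of "{X \<omega>}" borel X UNIV] by simp
  \<comment> \<open>The level set of \<open>?g\<close> through \<open>\<omega>\<close> lies in the
    sigma-algebra generated by \<open>X\<close>; it is a preimage under \<open>X\<close>, so it
    contains the whole fibre of \<open>\<omega>\<close>.\<close>
  have "?g -` {?g \<omega>} \<inter> space ?F \<in> sets ?F"
    by (rule measurable_sets[OF borel_measurable_cond_exp]) simp
  then obtain D where D: "?g -` {?g \<omega>} = X -` D"
    by (auto simp: sets_vimage_algebra2)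
  have const: "?g \<omega>' = ?g \<omega>" if "X \<omega>' = X \<omega>" for \<omega>'
  proof -
    have "\<omega> \<in> X -` D" using D by auto
    then have "\<omega>' \<in> X -` D" using that by simp
    then show ?thesis using D by auto
  qed
  have C: "C = S \<inter> ?B" "finite C" "\<omega> \<in> C" using S \<omega> by (auto simp: C_def)
  have avg: "(\<integral>x\<in>?B. f x \<partial>?M) = (\<Sum>x\<in>C. f x) / card S" for f :: "'a \<Rightarrow> real"
    unfolding set_lebesgue_integral_def C(1) using S S'
    by (simp add: integral_pmf_of_set sum.inter_restrict[of S] indicator_def if_distrib cong: if_cong)
  have "(\<integral>x\<in>?B. indicator A x \<partial>?M) = (\<integral>x\<in>?B. ?g x \<partial>?M)"
    using B by (intro real_cond_exp_intA) simp_all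
  then have "(\<Sum>x\<in>C. indicator A x) = (\<Sum>x\<in>C. ?g x)"
    using S' by (simp add: avg)
  also have "(\<Sum>x\<in>C. ?g x) = (\<Sum>x\<in>C. ?g \<omega>)"
    by (intro sum.cong refl const) (simp add: C_def)
  also have "(\<Sum>x\<in>C. indicator A x) = real (card (C \<inter> A))"
    using C by (simp add: sum.inter_restrict[symmetric] indicator_def sum.If_cases Int_def)
  finally show ?thesis
    using C(2,3) by (subst eq_divide_eq) (auto simp: cond_prob_given_def)
qed

section \<open>Variances of indicators and of conditional probabilities\<close>

text \<open>The two sides differ by the squared distance from \<open>c\<close> to the mean.\<close>

lemma (in prob_space) variance_le_expectation_sq_diff:
  fixes g :: "'a \<Rightarrow> real"
  assumes "integrable M g" "integrable M (\<lambda>x. (g x)\<^sup>2)"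
  shows "variance g \<le> expectation (\<lambda>x. (g x - c)\<^sup>2)"
proof -
  have "expectation (\<lambda>x. (g x - c)\<^sup>2) = expectation (\<lambda>x. (g x)\<^sup>2) - 2 * c * expectation g + c\<^sup>2"
    using assms by (simp add: power2_diff prob_space mult_ac)
  also have "\<dots> = variance g + (expectation g - c)\<^sup>2"
    using assms by (simp add: variance_eq) (simp add: power2_eq_square algebra_simps)
  finally show ?thesis by simp
qed

lemma (in prob_space) variance_indicator:
  assumes "A \<in> events"
  shows "variance (indicator A) = prob A * (1 - prob A)"
proof -
  have sq: "(indicator A x :: real)\<^sup>2 = indicator A x" for x by (simp add: indicator_def)
  have "integrable M (indicat_real A)"
    using assms by (intro integrable_const_bound[where B = 1]) simp_all
  then have "variance (indicat_real A) = expectation (indicator A) - (expectation (indicator A))\<^sup>2"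
    by (subst variance_eq) (simp_all add: sq)
  then show ?thesis
    using assms by (simp add: power2_eq_square algebra_simps)
qed

lemma measure_pmf_event: "A \<in> measure_pmf.events p"
  by simp

text \<open>The label is uniform on \<open>{1..N}\<close>, so the variance at threshold
  \<open>t\<close> is \<open>(N + 1 - t) * (t - 1) / N^2\<close>, to be averaged over
  \<open>t\<close>. The result depends on \<open>N\<close> alone, so all labelings share the same
  denominator.\<close>

lemma expectation_variance_upper_set_uniform:
  fixes \<tau> :: "'a \<Rightarrow> nat"
  assumes "bij_betw \<tau> S {1..N}" "N > 0"
  defines "p \<equiv> pmf_of_set S"
  shows "measure_pmf.expectation p
      (\<lambda>\<omega>. measure_pmf.variance p (indicator {\<omega>'. \<tau> \<omega>' \<ge> \<tau> \<omega>})) =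
    (1 - 1 / (real N)\<^sup>2) / 6"
proof -
  have S: "finite S" "card S = N" "S \<noteq> {}"
    using assms bij_betw_finite[OF assms(1)] bij_betw_same_card[OF assms(1)] by auto
  have prob: "measure_pmf.prob p {\<omega>. \<tau> \<omega> \<ge> t} = (real N + 1 - real t) / N" if "t \<in> {1..N}" for t
  proof -
    have "\<tau> ` (S \<inter> {\<omega>. \<tau> \<omega> \<ge> t}) = \<tau> ` S \<inter> {t..}"
      by auto
    also have "\<dots> = {t..N}"
      using that bij_betw_imp_surj_on[OF assms(1)] by auto
    finally have "card (S \<inter> {\<omega>. \<tau> \<omega> \<ge> t}) = card {t..N}"
      using card_image[OF inj_on_subset[OF bij_betw_imp_inj_on[OF assms(1)]], of "S \<inter> {\<omega>. \<tau> \<omega> \<ge> t}"]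
      by simp
    then show ?thesis
      using S that by (simp add: p_def measure_pmf_of_set of_nat_diff)
  qed
  \<comment> \<open>The upper limit \<open>m\<close> is separated from \<open>N\<close> so that
    induction can run with \<open>N\<close> fixed; at \<open>m = N\<close> the last factor becomes
    \<open>N + 1\<close>.\<close>
  have sum: "6 * (\<Sum>t=1..m. (real N + 1 - real t) * (real t - 1)) =
      real m * (real m - 1) * (3 * real N + 1 - 2 * real m)" for m
  proof (induction m)
    case (Suc m)
    have "6 * (\<Sum>t=1..Suc m. (real N + 1 - real t) * (real t - 1)) =
        real m * (real m - 1) * (3 * real N + 1 - 2 * real m) + 6 * ((real N - real m) * real m)"
      using Suc.IH by (simp add: distrib_left)
    also have "\<dots> = real (Suc m) * (real (Suc m) - 1) * (3 * real N + 1 - 2 * real (Suc m))"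
      by (simp add: algebra_simps)
    finally show ?case .
  qed simp
  have "measure_pmf.expectation p (\<lambda>\<omega>. measure_pmf.variance p (indicator {\<omega>'. \<tau> \<omega>' \<ge> \<tau> \<omega>}))
      = (\<Sum>\<omega>\<in>S. measure_pmf.prob p {\<omega>'. \<tau> \<omega>' \<ge> \<tau> \<omega>} * (1 - measure_pmf.prob p {\<omega>'. \<tau> \<omega>' \<ge> \<tau> \<omega>})) / N"
    unfolding measure_pmf.variance_indicator[OF measure_pmf_event]
    using S by (simp add: integral_pmf_of_set p_def)
  also have "\<dots> = (\<Sum>t=1..N. measure_pmf.prob p {\<omega>'. \<tau> \<omega>' \<ge> t} * (1 - measure_pmf.prob p {\<omega>'. \<tau> \<omega>' \<ge> t})) / N"
    by (subst sum.reindex_bij_betw[OF assms(1), symmetric]) simp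
  also have "\<dots> = (\<Sum>t=1..N. (real N + 1 - real t) * (real t - 1) / (real N)\<^sup>2) / N"
  proof (intro arg_cong2[where f = "(/)"] sum.cong refl)
    fix t assume t: "t \<in> {1..N}"
    have "1 - (real N + 1 - real t) / N = (real t - 1) / N"
      using \<open>N > 0\<close> by (simp add: field_simps)
    then show "measure_pmf.prob p {\<omega>'. \<tau> \<omega>' \<ge> t} * (1 - measure_pmf.prob p {\<omega>'. \<tau> \<omega>' \<ge> t}) =
        (real N + 1 - real t) * (real t - 1) / (real N)\<^sup>2"
      unfolding prob[OF t] by (simp add: power2_eq_square)
  qed
  also have "\<dots> = 6 * (\<Sum>t=1..N. (real N + 1 - real t) * (real t - 1)) / (6 * (real N) ^ 3)"
    by (simp add: sum_divide_distrib[symmetric] power2_eq_square power3_eq_cube)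
  also have "\<dots> = real N * (real N - 1) * (real N + 1) / (6 * (real N) ^ 3)"
    unfolding sum by (simp add: algebra_simps)
  also have "\<dots> = (1 - 1 / (real N)\<^sup>2) / 6"
    using \<open>N > 0\<close> by (simp add: field_simps power2_eq_square power3_eq_cube)
  finally show ?thesis .
qed


lemma cond_prob_given_pmf_of_set_bounds:
  fixes X :: "'a \<Rightarrow> 'b::t1_space"
  assumes "finite S" "\<omega> \<in> S"
  shows "cond_prob_given (measure_pmf (pmf_of_set S)) borel X A \<omega> \<in> {0..1}"
proof -
  have "card ({\<omega>'\<in>S. X \<omega>' = X \<omega>} \<inter> A) \<le> card {\<omega>'\<in>S. X \<omega>' = X \<omega>}"
    using assms by (intro card_mono) auto
  then show ?thesis
    by (auto simp: cond_prob_given_pmf_of_set[OF assms] divide_le_eq_1)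
qed

text \<open>The indicator and its conditional expectation \<open>g\<close> have the same mean, so
  their variances differ by the expectation of \<open>g - g^2\<close>. This integrand vanishes where
  \<open>g\<close> is 0 or 1 and is at most 1 on \<open>B\<close>.\<close>

lemma variance_cond_prob_given_ge:
  fixes X :: "'a \<Rightarrow> 'b::t1_space"
  assumes S: "finite S" "S \<noteq> {}"
  defines "p \<equiv> pmf_of_set S"
  assumes det: "\<And>\<omega>. \<omega> \<in> S - B \<Longrightarrow> cond_prob_given p borel X A \<omega> \<in> {0, 1}"
  shows "measure_pmf.variance p (cond_prob_given p borel X A) \<ge>
    measure_pmf.variance p (indicat_real A) - measure_pmf.prob p B"
proof -
  let ?g = "cond_prob_given p borel X A"
  have set: "set_pmf p = S" using S by (simp add: p_def)
  have int: "integrable p f" for f :: "'a \<Rightarrow> real"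
    using set S by (intro integrable_measure_pmf_finite) simp
  have mean: "measure_pmf.expectation p ?g = measure_pmf.prob p A"
    by (rule expectation_cond_prob_given_pmf) simp
  have "measure_pmf.expectation p (\<lambda>\<omega>. ?g \<omega> - (?g \<omega>)\<^sup>2) \<le> measure_pmf.expectation p (indicator B)"
  proof (intro integral_mono_AE int, unfold AE_measure_pmf_iff set, intro ballI)
    fix \<omega> assume \<omega>: "\<omega> \<in> S"
    have "?g \<omega> \<in> {0..1}"
      unfolding p_def using S \<omega> by (intro cond_prob_given_pmf_of_set_bounds)
    then show "?g \<omega> - (?g \<omega>)\<^sup>2 \<le> indicator B \<omega>"
      using det[of \<omega>] \<omega> order_trans[of "?g \<omega>" 1 "1 + (?g \<omega>)\<^sup>2"]
      by (cases "\<omega> \<in> B") (auto simp: diff_le_eq)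
  qed
  then have "measure_pmf.prob p A - measure_pmf.expectation p (\<lambda>\<omega>. (?g \<omega>)\<^sup>2) \<le> measure_pmf.prob p B"
    by (simp add: int mean)
  moreover have "measure_pmf.variance p ?g =
      measure_pmf.expectation p (\<lambda>\<omega>. (?g \<omega>)\<^sup>2) - (measure_pmf.prob p A)\<^sup>2"
    unfolding mean[symmetric] by (rule measure_pmf.variance_eq[OF int int])
  moreover have "measure_pmf.variance p (indicat_real A) =
      measure_pmf.prob p A - (measure_pmf.prob p A)\<^sup>2"
    unfolding measure_pmf.variance_indicator[OF measure_pmf_event]
    by (simp add: power2_eq_square algebra_simps)
  ultimately show ?thesis by linarith
qed

lemma variance_le_of_near_const:
  fixes g :: "'a \<Rightarrow> real"
  assumes "finite (set_pmf p)" "\<And>\<omega>. \<omega> \<in> set_pmf p \<Longrightarrow> \<bar>g \<omega> - c\<bar> \<le> \<delta>"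
  shows "measure_pmf.variance p g \<le> \<delta>\<^sup>2"
proof -
  have int: "integrable p f" for f :: "'a \<Rightarrow> real"
    using assms by (intro integrable_measure_pmf_finite)
  have "measure_pmf.variance p g \<le> measure_pmf.expectation p (\<lambda>\<omega>. (g \<omega> - c)\<^sup>2)"
    by (intro measure_pmf.variance_le_expectation_sq_diff int)
  also have "\<dots> \<le> measure_pmf.expectation p (\<lambda>\<omega>. \<delta>\<^sup>2)"
    using assms(2)
    by (intro integral_mono_AE int) (auto simp: AE_measure_pmf_iff abs_le_square_iff[symmetric] intro: order_trans[OF _ abs_ge_self])
  finally show ?thesis by simp
qed

text \<open>At \<open>N = 2\<close> the closed form is \<open>(1 - 1/4) / 6 = 1/8\<close>, and it
  grows with \<open>N\<close>. The factor 8 in the bounds on the coefficient is the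
  reciprocal.\<close>

lemma expectation_variance_upper_set_uniform_ge:
  fixes \<tau> :: "'a \<Rightarrow> nat"
  assumes "bij_betw \<tau> S {1..N}" "N \<ge> 2"
  defines "p \<equiv> pmf_of_set S"
  shows "measure_pmf.expectation p
      (\<lambda>\<omega>. measure_pmf.variance p (indicat_real {\<omega>'. \<tau> \<omega>' \<ge> \<tau> \<omega>})) \<ge> 1 / 8"
proof -
  have "(real N)\<^sup>2 \<ge> 2\<^sup>2"
    using assms by (intro power_mono) auto
  then have "1 / (real N)\<^sup>2 \<le> 1 / 4"
    using assms by (intro divide_left_mono) auto
  moreover have "N > 0" using assms by simp
  ultimately show ?thesis
    unfolding p_def by (subst expectation_variance_upper_set_uniform[OF assms(1)]) simp_all
qed

section \<open>Bounds on the coefficient for uniform labels\<close>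

text \<open>At each threshold, conditioning loses at most \<open>\<delta>\<close> of the variance,
  so the numerator is at least \<open>?D - \<delta>\<close>; since \<open>?D >= 1/8\<close>, the
  relative loss is at most \<open>8 * \<delta>\<close>.\<close>

lemma chatterjee_xi_uniform_ge:
  fixes X :: "'a \<Rightarrow> 'b::t1_space" and \<tau> :: "'a \<Rightarrow> nat"
  assumes bij: "bij_betw \<tau> S {1..N}" and N: "N \<ge> 2"
  defines "p \<equiv> pmf_of_set S"
  assumes B: "\<And>t. t \<in> {1..N} \<Longrightarrow> measure_pmf.prob p (B t) \<le> \<delta>"
    and det: "\<And>t \<omega>. t \<in> {1..N} \<Longrightarrow> \<omega> \<in> S - B t \<Longrightarrow>
      cond_prob_given p borel X {\<omega>'. \<tau> \<omega>' \<ge> t} \<omega> \<in> {0, 1}"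
  shows "chatterjee_xi p borel X (\<lambda>\<omega>. real (\<tau> \<omega>)) \<ge> 1 - 8 * \<delta>"
proof -
  let ?A = "\<lambda>\<omega>. {\<omega>'. \<tau> \<omega>' \<ge> \<tau> \<omega>}"
  let ?V = "\<lambda>f. measure_pmf.variance p f"
  let ?D = "measure_pmf.expectation p (\<lambda>\<omega>. ?V (indicat_real (?A \<omega>)))"
  let ?E = "measure_pmf.expectation p (\<lambda>\<omega>. ?V (cond_prob_given p borel X (?A \<omega>)))"
  have S: "finite S" "S \<noteq> {}"
    using N bij_betw_finite[OF bij] bij_betw_imp_surj_on[OF bij] by auto
  have set: "set_pmf p = S" using S by (simp add: p_def)
  have int: "integrable p f" for f :: "'a \<Rightarrow> real"
    using set S by (intro integrable_measure_pmf_finite) simp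
  have D: "?D \<ge> 1 / 8"
    unfolding p_def by (rule expectation_variance_upper_set_uniform_ge[OF bij N])
  \<comment> \<open>The sign of \<open>\<delta>\<close> is read off from the bound at threshold 1;
    it allows \<open>?D >= 1/8\<close> to be multiplied by \<open>8 * \<delta>\<close>.\<close>
  have "1 \<in> {1..N}" using N by simp
  then have \<delta>: "\<delta> \<ge> 0" using B order_trans[OF measure_nonneg] by blast
  have "?D - \<delta> = measure_pmf.expectation p (\<lambda>\<omega>. ?V (indicat_real (?A \<omega>)) - \<delta>)"
    by (simp add: int)
  also have "\<dots> \<le> ?E"
  proof (intro integral_mono_AE int, unfold AE_measure_pmf_iff set, intro ballI)
    fix \<omega> assume "\<omega> \<in> S"
    then have "\<tau> \<omega> \<in> {1..N}" using bij_betw_apply[OF bij] by blast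
    then show "?V (indicat_real (?A \<omega>)) - \<delta> \<le> ?V (cond_prob_given p borel X (?A \<omega>))"
      using variance_cond_prob_given_ge[OF S, of "B (\<tau> \<omega>)" X "?A \<omega>"] det[of "\<tau> \<omega>"] B[of "\<tau> \<omega>"]
      unfolding p_def by fastforce
  qed
  finally have "?D - \<delta> \<le> ?E" .
  moreover have "\<delta> \<le> 8 * \<delta> * ?D"
    using mult_left_mono[OF D, of "8 * \<delta>"] \<delta> by simp
  ultimately have "(1 - 8 * \<delta>) * ?D \<le> ?E"
    by (simp add: left_diff_distrib)
  then show ?thesis
    unfolding chatterjee_xi_pmf using D by (subst pos_le_divide_eq) auto
qed

text \<open>The centre \<open>c t\<close> may vary with the threshold but not with the sample point,
  so each variance in the numerator is at most \<open>\<delta>^2\<close>.\<close>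

lemma chatterjee_xi_uniform_le:
  fixes X :: "'a \<Rightarrow> 'b::t1_space" and \<tau> :: "'a \<Rightarrow> nat"
  assumes bij: "bij_betw \<tau> S {1..N}" and N: "N \<ge> 2"
  defines "p \<equiv> pmf_of_set S"
  assumes near: "\<And>t \<omega>. t \<in> {1..N} \<Longrightarrow> \<omega> \<in> S \<Longrightarrow>
      \<bar>cond_prob_given p borel X {\<omega>'. \<tau> \<omega>' \<ge> t} \<omega> - c t\<bar> \<le> \<delta>"
  shows "chatterjee_xi p borel X (\<lambda>\<omega>. real (\<tau> \<omega>)) \<le> 8 * \<delta>\<^sup>2"
proof -
  let ?A = "\<lambda>\<omega>. {\<omega>'. \<tau> \<omega>' \<ge> \<tau> \<omega>}"
  let ?V = "\<lambda>f. measure_pmf.variance p f"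
  let ?D = "measure_pmf.expectation p (\<lambda>\<omega>. ?V (indicat_real (?A \<omega>)))"
  let ?E = "measure_pmf.expectation p (\<lambda>\<omega>. ?V (cond_prob_given p borel X (?A \<omega>)))"
  have S: "finite S" "S \<noteq> {}"
    using N bij_betw_finite[OF bij] bij_betw_imp_surj_on[OF bij] by auto
  have set: "set_pmf p = S" using S by (simp add: p_def)
  have int: "integrable p f" for f :: "'a \<Rightarrow> real"
    using set S by (intro integrable_measure_pmf_finite) simp
  have D: "?D \<ge> 1 / 8"
    unfolding p_def by (rule expectation_variance_upper_set_uniform_ge[OF bij N])
  have "?E \<le> measure_pmf.expectation p (\<lambda>_. \<delta>\<^sup>2)"
  proof (intro integral_mono_AE int, unfold AE_measure_pmf_iff set, intro ballI)
    fix \<omega> assume "\<omega> \<in> S"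
    then have "\<tau> \<omega> \<in> {1..N}" using bij_betw_apply[OF bij] by blast
    then show "?V (cond_prob_given p borel X (?A \<omega>)) \<le> \<delta>\<^sup>2"
      using S set near by (intro variance_le_of_near_const[where c = "c (\<tau> \<omega>)"]) auto
  qed
  also have "\<dots> \<le> 8 * \<delta>\<^sup>2 * ?D"
    using mult_left_mono[OF D, of "8 * \<delta>\<^sup>2"] by simp
  finally show ?thesis
    unfolding chatterjee_xi_pmf using D by (subst pos_divide_le_eq) auto
qed

text \<open>Finiteness makes \<open>MAX\<close> and \<open>MIN\<close> over the labelings genuine
  extrema; extensionality places the labelings in a finite product.\<close>

lemma finite_labelings:
  assumes "finite L"
  shows "finite (labelings L)"
proof (rule finite_subset)
  show "labelings L \<subseteq> PiE L (\<lambda>_. {1..card L})"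
    by (auto simp: labelings_def bij_betw_def PiE_def)
  show "finite (PiE L (\<lambda>_. {1..card L}))"
    using assms by (intro finite_PiE) auto
qed

section \<open>The block design and its two extreme labelings\<close>

text \<open>
  Level \<open>k = i * n + b\<close> lies in block \<open>i\<close>, and \<open>X\<close> is the block of \<open>Y\<close>. The sample space consists of
  the reals \<open>0, \<dots>, n * n - 1\<close>; \<open>mod (n * n)\<close> only keeps \<open>Y\<close> in its range off the support.
\<close>

locale block_design =
  fixes n :: nat
  assumes n: "n \<ge> 2"
begin

definition S :: "real set" where "S = real ` {..<n * n}"
definition X :: "real \<Rightarrow> real" where "X \<omega> = real (nat \<lfloor>\<omega>\<rfloor> div n)"
definition Y :: "real \<Rightarrow> nat" where "Y \<omega> = nat \<lfloor>\<omega>\<rfloor> mod (n * n)"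

lemma n_pos: "n > 0" and nn_ge_2: "n * n \<ge> 2"
  using n mult_le_mono[of 2 n 1 n] by auto

lemma finite_S: "finite S" and S_nonempty: "S \<noteq> {}" and card_S: "card S = n * n"
  using n_pos by (auto simp: S_def card_image lessThan_empty_iff)

lemma bij_betw_Y: "bij_betw Y S {..<n * n}"
  unfolding S_def Y_def by (rule bij_betwI[where g = real]) auto

lemma block_index_less:
  fixes i b :: nat
  assumes "i < n" "b < n"
  shows "i * n + b < n * n"
proof -
  have "i * n + b < Suc i * n" using assms by simp
  also have "\<dots> \<le> n * n" using assms by (intro mult_le_mono1) simp
  finally show ?thesis .
qed

lemma in_S_cases:
  assumes "\<omega> \<in> S"
  obtains i b where "i < n" "b < n" "\<omega> = real (i * n + b)"
proof -
  obtain k where k: "k < n * n" "\<omega> = real k" using assms by (auto simp: S_def)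
  show thesis
    using k n_pos by (intro that[of "k div n" "k mod n"]) (auto simp: less_mult_imp_div_less)
qed

text \<open>The fibre of \<open>X\<close> through level \<open>i * n + b\<close> is block
  \<open>i\<close>, consisting of \<open>n\<close> equally likely levels, so only the labels within
  that block are counted.\<close>

lemma cond_prob_block:
  assumes "i < n" "b < n"
  shows "cond_prob_given (measure_pmf (pmf_of_set S)) borel X {\<omega>. l (Y \<omega>) \<ge> t} (real (i * n + b)) =
    real (card {b. b < n \<and> l (i * n + b) \<ge> (t::nat)}) / real n"
proof -
  let ?f = "\<lambda>b. real (i * n + b)"
  let ?C = "{\<omega>'\<in>S. X \<omega>' = X (real (i * n + b))}"
  have fibre: "?C = ?f ` {..<n}"
  proof (intro equalityI subsetI)
    fix \<omega> assume "\<omega> \<in> ?C"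
    then obtain j b' where "b' < n" "\<omega> = real (j * n + b')"
        "X (real (j * n + b')) = X (real (i * n + b))"
      by (auto elim: in_S_cases)
    then show "\<omega> \<in> ?f ` {..<n}"
      using assms by (auto simp: X_def simp del: of_nat_add of_nat_mult)
  next
    fix \<omega> assume "\<omega> \<in> ?f ` {..<n}"
    then show "\<omega> \<in> ?C"
      using assms block_index_less by (auto simp: X_def S_def simp del: of_nat_add of_nat_mult)
  qed
  have inj: "inj_on ?f A" for A by (auto simp: inj_on_def)
  have Yf: "Y (?f b') = i * n + b'" if "b' < n" for b'
    using block_index_less[OF assms(1) that] by (simp add: Y_def del: of_nat_add of_nat_mult)
  have "?C \<inter> {\<omega>. l (Y \<omega>) \<ge> t} = ?f ` {b. b < n \<and> l (i * n + b) \<ge> t}"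
    unfolding fibre using Yf by (auto simp del: of_nat_add of_nat_mult)
  then have "card (?C \<inter> {\<omega>. l (Y \<omega>) \<ge> t}) = card {b. b < n \<and> l (i * n + b) \<ge> t}"
    by (simp add: card_image[OF inj] del: of_nat_add of_nat_mult)
  moreover have "card ?C = n"
    unfolding fibre by (simp add: card_image[OF inj] del: of_nat_add of_nat_mult)
  moreover have "real (i * n + b) \<in> S"
    unfolding S_def using block_index_less[OF assms] by (intro imageI) simp
  ultimately show ?thesis
    by (simp add: cond_prob_given_pmf_of_set[OF finite_S] del: of_nat_add of_nat_mult)
qed

lemma labeling_bij:
  assumes "l \<in> labelings {..<n * n}"
  shows "bij_betw (\<lambda>\<omega>. l (Y \<omega>)) S {1..n * n}"
  using bij_betw_trans[OF bij_betw_Y, of l "{1..n * n}"] assms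
  by (simp add: labelings_def comp_def)

definition lex_labeling :: "nat \<Rightarrow> nat" where
  "lex_labeling = restrict Suc {..<n * n}"

text \<open>Transposes the grid of pairs (block, position): consecutive labels run across the
  blocks. The successor shifts labels to start at 1.\<close>

definition colex_labeling :: "nat \<Rightarrow> nat" where
  "colex_labeling = restrict (\<lambda>k. Suc ((k mod n) * n + k div n)) {..<n * n}"

lemma lex_labeling_in: "lex_labeling \<in> labelings {..<n * n}"
proof -
  have "bij_betw Suc {..<n * n} {1..n * n}"
    by (rule bij_betwI[where g = "\<lambda>k. k - 1"]) auto
  then show ?thesis
    by (simp add: labelings_def lex_labeling_def)
qed

lemma colex_labeling_in: "colex_labeling \<in> labelings {..<n * n}"
proof -
  let ?s = "\<lambda>k. (k mod n) * n + k div n"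
  \<comment> \<open>Swapping the two base-\<open>n\<close> digits is an involution, so
    \<open>?s\<close> serves as its own inverse.\<close>
  have s: "?s k < n * n \<and> ?s (?s k) = k" if "k < n * n" for k
    using that n_pos block_index_less[of "k mod n" "k div n"] by (simp add: less_mult_imp_div_less)
  have "bij_betw (\<lambda>k. Suc (?s k)) {..<n * n} {1..n * n}"
    by (rule bij_betwI[where g = "\<lambda>k. ?s (k - 1)"]) (use s in \<open>auto simp: Suc_le_eq\<close>)
  then show ?thesis
    by (simp add: labelings_def colex_labeling_def)
qed

lemma lex_labeling_block: "lex_labeling (i * n + b) = Suc (i * n + b)"
  and colex_labeling_block: "colex_labeling (i * n + b) = Suc (b * n + i)"
  if "i < n" "b < n"
  using block_index_less[OF that] that by (auto simp: lex_labeling_def colex_labeling_def)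

lemma xi_lex:
  "chatterjee_xi (measure_pmf (pmf_of_set S)) borel X (\<lambda>\<omega>. real (lex_labeling (Y \<omega>))) \<ge> 1 - 8 * (1 / real n)"
proof (rule chatterjee_xi_uniform_ge[OF labeling_bij[OF lex_labeling_in] nn_ge_2])
  fix t assume t: "t \<in> {1..n * n}"
  \<comment> \<open>Labels exceed levels by one, so threshold \<open>t\<close> is the label of level
    \<open>t - 1\<close>, which lies in block \<open>a\<close>. That block is the exceptional set
    \<open>?B t\<close>: it has \<open>n\<close> of the \<open>n * n\<close> points.\<close>
  define a where "a = (t - 1) div n"
  let ?B = "\<lambda>t. (\<lambda>b. real ((t - 1) div n * n + b)) ` {..<n}"
  have "card (S \<inter> ?B t) \<le> card (?B t)"
    by (intro card_mono) auto
  also have "\<dots> \<le> n"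
    using card_image_le[of "{..<n}"] by simp
  finally show "measure_pmf.prob (pmf_of_set S) (?B t) \<le> 1 / real n"
    using n_pos finite_S S_nonempty card_S by (simp add: measure_pmf_of_set divide_simps)
  fix \<omega> assume \<omega>: "\<omega> \<in> S - ?B t"
  then obtain i b where ib: "i < n" "b < n" "\<omega> = real (i * n + b)"
    by (auto elim: in_S_cases)
  then have "i \<noteq> a" using \<omega> by (auto simp: a_def)
  have eq: "{b. b < n \<and> lex_labeling (i * n + b) \<ge> t} = {b. b < n \<and> i * n + b \<ge> t - 1}"
    using ib t by (auto simp: lex_labeling_block)
  have ta: "a * n \<le> t - 1" "t - 1 < Suc a * n"
    using n_pos dividend_less_div_times[of n "t - 1"] by (auto simp: a_def)
  \<comment> \<open>Blocks before \<open>a\<close> lie wholly below the threshold and blocks after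
    \<open>a\<close> wholly above it, giving conditional probability 0 or 1.\<close>
  consider "i < a" | "a < i" using \<open>i \<noteq> a\<close> by linarith
  then show "cond_prob_given (measure_pmf (pmf_of_set S)) borel X {\<omega>'. lex_labeling (Y \<omega>') \<ge> t} \<omega> \<in> {0, 1}"
  proof cases
    case 1
    then have "Suc i * n \<le> a * n" by (intro mult_le_mono1) simp
    then have "{b. b < n \<and> i * n + b \<ge> t - 1} = {}" using ta by auto
    then show ?thesis by (simp only: ib(3) cond_prob_block[OF ib(1,2)] eq) simp
  next
    case 2
    then have "Suc a * n \<le> i * n" by (intro mult_le_mono1) simp
    then have "{b. b < n \<and> i * n + b \<ge> t - 1} = {..<n}" using ta by auto
    then show ?thesis using n_pos by (simp only: ib(3) cond_prob_block[OF ib(1,2)] eq) simp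
  qed
qed

text \<open>Within any block, positions above \<open>a\<close> reach the threshold and positions
  below \<open>a\<close> do not; only position \<open>a\<close> depends on the block. The count is
  therefore \<open>n - Suc a\<close> or \<open>n - a\<close>, and the conditional probability moves
  by at most \<open>1 / n\<close>.\<close>

lemma xi_colex:
  "chatterjee_xi (measure_pmf (pmf_of_set S)) borel X (\<lambda>\<omega>. real (colex_labeling (Y \<omega>))) \<le> 8 * (1 / real n)\<^sup>2"
proof (rule chatterjee_xi_uniform_le[OF labeling_bij[OF colex_labeling_in] nn_ge_2])
  fix t \<omega> assume t: "t \<in> {1..n * n}" and \<omega>: "\<omega> \<in> S"
  define a where "a = (t - 1) div n"
  obtain i b where ib: "i < n" "b < n" "\<omega> = real (i * n + b)"
    using \<omega> by (auto elim: in_S_cases)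
  let ?G = "{b. b < n \<and> colex_labeling (i * n + b) \<ge> t}"
  have eq: "?G = {b. b < n \<and> b * n + i \<ge> t - 1}"
    using ib t by (auto simp: colex_labeling_block)
  have a: "a < n" using t n_pos by (auto simp: a_def intro!: less_mult_imp_div_less)
  have ta: "a * n \<le> t - 1" "t - 1 < Suc a * n"
    using n_pos dividend_less_div_times[of n "t - 1"] by (auto simp: a_def)
  have "{Suc a..<n} \<subseteq> ?G"
  proof
    fix b assume "b \<in> {Suc a..<n}"
    then have "Suc a * n \<le> b * n" "b < n" by (simp_all del: mult_Suc)
    then show "b \<in> ?G" unfolding eq using ta by simp
  qed
  then have lo: "n - Suc a \<le> card ?G"
    using card_mono[of ?G "{Suc a..<n}"] by simp
  have "?G \<subseteq> {a..<n}"
  proof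
    fix b assume b: "b \<in> ?G"
    have "\<not> b < a"
    proof
      assume "b < a"
      then have "Suc b * n \<le> a * n" by (intro mult_le_mono1) simp
      then show False using b ib ta unfolding eq by simp
    qed
    then show "b \<in> {a..<n}" using b by simp
  qed
  then have hi: "card ?G \<le> n - a"
    using card_mono[of "{a..<n}" ?G] by simp
  have "\<bar>real (card ?G) - real (n - Suc a)\<bar> \<le> 1"
    using lo hi a by linarith
  then have "\<bar>real (card ?G) / n - real (n - Suc a) / n\<bar> \<le> 1 / real n"
    using n_pos by (simp add: diff_divide_distrib[symmetric] divide_right_mono)
  then show "\<bar>cond_prob_given (measure_pmf (pmf_of_set S)) borel X {\<omega>'. colex_labeling (Y \<omega>') \<ge> t} \<omega> -
      real (n - Suc ((t - 1) div n)) / real n\<bar> \<le> 1 / real n"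
    by (simp only: ib(3) cond_prob_block[OF ib(1,2)] a_def)
qed

lemma categorical_Y: "categorical_rv (pmf_of_set S) {..<n * n} Y"
proof -
  have "measure_pmf.prob (pmf_of_set S) {\<omega>. Y \<omega> = y} > 0" if "y < n * n" for y
  proof -
    have "real y \<in> S \<inter> {\<omega>. Y \<omega> = y}"
      using that by (auto simp: S_def Y_def)
    then show ?thesis
      using finite_S S_nonempty
      by (subst measure_pmf_of_set) (auto simp: card_gt_0_iff intro!: divide_pos_pos)
  qed
  moreover have "Y \<in> measurable (measure_pmf (pmf_of_set S)) (count_space {..<n * n})"
    using n_pos by (auto simp: Y_def)
  ultimately show ?thesis
    by (auto simp: categorical_rv_def)
qed

text \<open>Every point of \<open>S\<close> has positive mass and the labels 1 and 2 both occur.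
  This rules out the degenerate quotient with zero denominator.\<close>

lemma labeling_not_as_constant:
  assumes "l \<in> labelings {..<n * n}"
  shows "\<not> as_constant (pmf_of_set S) (\<lambda>\<omega>. real (l (Y \<omega>)))"
proof
  assume "as_constant (pmf_of_set S) (\<lambda>\<omega>. real (l (Y \<omega>)))"
  then obtain c where c: "\<And>\<omega>. \<omega> \<in> S \<Longrightarrow> real (l (Y \<omega>)) = c"
    using finite_S S_nonempty by (auto simp: as_constant_def AE_measure_pmf_iff)
  have img: "(\<lambda>\<omega>. l (Y \<omega>)) ` S = {1..n * n}"
    using labeling_bij[OF assms] by (rule bij_betw_imp_surj_on)
  have "real k = c" if "k \<in> {1..n * n}" for k
    using that c unfolding img[symmetric] by auto
  from this[of 1] this[of 2] show False
    using nn_ge_2 n_pos by simp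
qed

end

theorem proposition1:
  fixes \<epsilon> :: real
  assumes "\<epsilon> > 0"
  shows "\<exists>(M :: real measure) (K :: nat) (L :: nat set) (Y :: real \<Rightarrow> nat) (X :: real \<Rightarrow> real).
    prob_space M \<and>
    X \<in> borel_measurable M \<and>
    categorical_rv M L Y \<and> card L = K \<and>
    (\<forall>l\<in>labelings L. \<not> as_constant M (\<lambda>\<omega>. real (l (Y \<omega>)))) \<and>
    (MAX l\<in>labelings L. chatterjee_xi M borel X (\<lambda>\<omega>. real (l (Y \<omega>))))
      - (MIN l\<in>labelings L. chatterjee_xi M borel X (\<lambda>\<omega>. real (l (Y \<omega>)))) > 1 - \<epsilon>"
proof -
  \<comment> \<open>The two errors are \<open>8 / n\<close> and \<open>8 / n^2 <= 8 / n\<close>;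
    together they are at most \<open>16 / n\<close>, which must be below
    \<open>\<epsilon>\<close>.\<close>
  obtain m :: nat where m: "16 / \<epsilon> < real m"
    using reals_Archimedean2 by blast
  define n where "n = max m 2"
  have n_gt: "16 / \<epsilon> < real n" and "n \<ge> 2" using m by (auto simp: n_def)
  interpret block_design n by unfold_locales fact
  let ?M = "measure_pmf (pmf_of_set S)" and ?L = "{..<n * n}"
  let ?xi = "\<lambda>l. chatterjee_xi ?M borel X (\<lambda>\<omega>. real (l (Y \<omega>)))"
  have fin: "finite (?xi ` labelings ?L)"
    by (intro finite_imageI finite_labelings) simp
  \<comment> \<open>One labeling on each side suffices: its value bounds the maximum from below or
    the minimum from above.\<close>
  have "?xi lex_labeling \<le> Max (?xi ` labelings ?L)"
    using fin lex_labeling_in by (intro Max_ge) auto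
  moreover have "Min (?xi ` labelings ?L) \<le> ?xi colex_labeling"
    using fin colex_labeling_in by (intro Min_le) auto
  moreover have "(1 / real n)\<^sup>2 \<le> 1 / real n"
    using \<open>n \<ge> 2\<close> by (simp add: power2_eq_square field_simps)
  moreover have "16 * (1 / real n) < \<epsilon>"
    using n_gt n_pos \<open>\<epsilon> > 0\<close> by (simp add: field_simps)
  ultimately have "Max (?xi ` labelings ?L) - Min (?xi ` labelings ?L) > 1 - \<epsilon>"
    using xi_lex xi_colex by linarith
  then show ?thesis
    using categorical_Y labeling_not_as_constant
    by (intro exI[of _ ?M] exI[of _ "n * n"] exI[of _ ?L] exI[of _ Y] exI[of _ X])
      (auto simp: measure_pmf.prob_space_axioms)
qed

end
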